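(* For all integers $k \ge 0$ it holds that $S'_2(k) = 2 \cdot a_2(k)$.
   Context: The sequence $S'_2 : \mathbb{N}_0 \to \mathbb{N}_0$ (with $\mathbb{N}_0 = \{0,1,2,\dots\}$) is defined recursively: $S'_2(0) := 0$, $S'_2(1) := 2$, and for $k \ge 2$, $S'_2(k) := 2 \cdot (k-i+1)$ for the minimal $i \in \{1,\dots,k-1\}$ with $k-i+1 \le S'_2(i)$ (such an $i$ always exists). The sequence $a_2 : \mathbb{N}_0 \to \mathbb{N}_0$ is defined by $a_2(0) = 0$, $a_2(1) = 1$, and for $k \ge 2$ by the nested recursion $a_2(k) = a_2(k - a_2(k-1)) + a_2(k - 1 - a_2(k-2))$. *)

theory Defs
  imports Main
begin

text \<open>The congruence rule makes the bound on \<open>i\<close> available in the termination proof.\<close>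

declare conj_cong [fundef_cong]

function S2' :: "nat \<Rightarrow> nat" where
  "S2' 0 = 0"
| "S2' (Suc 0) = 2"
| "k \<ge> 2 \<Longrightarrow> S2' k =
    (let i = (LEAST i. i \<in> {1..k - 1} \<and> k - i + 1 \<le> S2' i) in 2 * (k - i + 1))"
  by atomize_elim (auto simp: not_less_eq_eq numeral_2_eq_2 intro: Suc_leI)
termination
  by (relation "measure id") auto

declare conj_cong [fundef_cong del]
declare S2'.simps(3) [simp del]

text \<open>The minimum in the recursion is always taken over a nonempty set.\<close>

lemma S2'_ge_2:
  assumes "k \<ge> 1"
  shows "S2' k \<ge> 2"
proof (cases "k \<ge> 2")
  case True
  show ?thesis by (subst S2'.simps(3)[OF True]) (simp add: Let_def del: One_nat_def)
next
  case False
  then have "k = Suc 0" using assms by simp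
  then show ?thesis by simp
qed

lemma S2'_index_exists:
  assumes "k \<ge> 2"
  shows "\<exists>i \<in> {1..k - 1}. k - i + 1 \<le> S2' i"
proof (rule bexI)
  have "1 \<le> k - 1" using assms by linarith
  then show "k - 1 \<in> {1..k - 1}" by simp
  have "k - (k - 1) + 1 = 2" using assms by linarith
  then show "k - (k - 1) + 1 \<le> S2' (k - 1)"
    using S2'_ge_2[OF \<open>1 \<le> k - 1\<close>] by simp
qed

function (domintros) a2 :: "nat \<Rightarrow> nat" where
  "a2 0 = 0"
| "a2 (Suc 0) = 1"
| "k \<ge> 2 \<Longrightarrow> a2 k = a2 (k - a2 (k - 1)) + a2 (k - 1 - a2 (k - 2))"
  by atomize_elim (auto simp: not_less_eq_eq numeral_2_eq_2 intro: Suc_leI)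

text \<open>Termination of this nested recursion depends on the values of the function itself;
  it is shown together with the fact that consecutive values differ by \<open>0\<close> or \<open>1\<close>.
  The bound \<open>a2 n \<le> n\<close> shows that none of the subtractions in the recursion is truncated.\<close>

lemma a2_dom_slow:
  "a2_dom n \<and> a2 n \<le> n \<and>
   (n \<ge> 1 \<longrightarrow> 1 \<le> a2 n \<and> a2 (n - 1) \<le> a2 n \<and> a2 n \<le> a2 (n - 1) + 1)"
proof (induction n rule: less_induct)
  case (less n)
  have dom0: "a2_dom 0" and dom1: "a2_dom (Suc 0)"
    by (rule a2.domintros)+
  have v0: "a2 0 = 0" and v1: "a2 (Suc 0) = 1"
    using a2.psimps(1)[OF dom0] a2.psimps(2)[OF dom1] by auto
  have rec: "a2 m = a2 (m - a2 (m - 1)) + a2 (m - 1 - a2 (m - 2))"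
    if "a2_dom m" "m \<ge> 2" for m
    using a2.psimps(3)[OF that(2,1)] .
  have dom: "a2_dom n"
  proof (cases "n \<ge> 2")
    case True
    have "1 \<le> a2 (n - 1)" using less[of "n - 1"] True by simp
    then have lt: "n - Suc 0 < n" "n - a2 (n - Suc 0) < n" "n - 2 < n" "n - Suc (a2 (n - 2)) < n"
      using True by simp_all
    show ?thesis
      by (rule a2.domintros(3)) (use True lt less in blast)+
  next
    case False
    then have "n = 0 \<or> n = Suc 0" by auto
    then show ?thesis using dom0 dom1 by auto
  qed
  have IHd: "a2_dom m" and IHle: "a2 m \<le> m" if "m < n" for m
    using less[OF that] by auto
  have IHpos: "1 \<le> a2 m" if "m < n" "1 \<le> m" for m
    using less[OF that(1)] that by auto
  have IHs: "a2 m \<le> a2 (Suc m) \<and> a2 (Suc m) \<le> a2 m + 1" if "Suc m < n" for m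
    using less[OF that] by auto
  have v2: "a2 2 = 2" if "a2_dom 2"
    using rec[OF that] v0 v1 by (simp add: numeral_2_eq_2)
  consider "n = 0" | "n = Suc 0" | "n = 2" | "n = 3" | "n \<ge> 4" by linarith
  then show ?case
  proof cases
    case 1
    then show ?thesis using dom v0 by auto
  next
    case 2
    then show ?thesis using dom v0 v1 by auto
  next
    case 3
    then show ?thesis using dom v1 v2 by auto
  next
    case 4
    have "a2 2 = 2" using v2 IHd[of 2] 4 by auto
    moreover have "a2 3 = 2"
      using rec[of 3] dom 4 v1 calculation by (simp add: numeral_3_eq_3 numeral_2_eq_2)
    ultimately show ?thesis using dom 4 by auto
  next
    case 5
    define j where "j = n - 4"
    have n: "n = Suc (Suc (Suc (Suc j)))" using 5 by (auto simp: j_def)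
    define A B C D where "A = a2 j" and "B = a2 (Suc j)" and "C = a2 (Suc (Suc j))"
      and "D = a2 (Suc (Suc (Suc j)))"
    have steps: "A \<le> B" "B \<le> A + 1" "B \<le> C" "C \<le> B + 1" "C \<le> D" "D \<le> C + 1"
      using IHs[of j] IHs[of "Suc j"] IHs[of "Suc (Suc j)"]
      by (auto simp: n A_def B_def C_def D_def)
    have bounds: "A \<le> j" "B \<le> Suc j" "C \<le> Suc (Suc j)" "D \<le> Suc (Suc (Suc j))"
      "1 \<le> B" "1 \<le> C" "1 \<le> D"
      using IHle IHpos by (auto simp: n A_def B_def C_def D_def)
    define p q r s where "p = Suc j - A" and "q = Suc (Suc j) - B"
      and "r = Suc (Suc (Suc j)) - C" and "s = n - D"
    have pq: "q = p \<or> q = Suc p" and qr: "r = q \<or> r = Suc q"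
      and rs: "s = r \<or> s = Suc r"
      and CD: "s = Suc r \<longleftrightarrow> D = C" and sn: "s < n"
      using steps bounds by (auto simp: p_def q_def r_def s_def n)
    have eqn: "a2 n = a2 s + a2 r"
      using rec[OF dom] by (simp add: n s_def r_def C_def D_def)
    have eqD: "D = a2 r + a2 q"
      using rec[OF IHd, of "Suc (Suc (Suc j))"]
      by (simp add: n r_def q_def B_def C_def D_def)
    have eqC: "C = a2 q + a2 p"
      using rec[OF IHd, of "Suc (Suc j)"]
      by (simp add: n q_def p_def A_def B_def C_def)
    have mono_pq: "a2 p \<le> a2 q" "a2 q \<le> a2 p + 1"
      using pq qr rs sn IHs[of p] by auto
    have mono_qr: "a2 q \<le> a2 r" "a2 r \<le> a2 q + 1"
      using qr rs sn IHs[of q] by auto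
    have mono_rs: "a2 r \<le> a2 s" "a2 s \<le> a2 r + 1"
      using rs sn IHs[of r] by auto
    have up: "D \<le> a2 n" using eqn eqD mono_qr mono_rs by linarith
    have le: "a2 n \<le> D + 1"
    proof (cases "D = C")
      case True
      then have "a2 r = a2 q" using eqC eqD mono_pq mono_qr by linarith
      then show ?thesis using eqn eqD mono_rs by linarith
    next
      case False
      then have "s = r" using CD rs by auto
      then show ?thesis using eqn eqD mono_qr by simp
    qed
    have "n - 1 = Suc (Suc (Suc j))" using n by simp
    then show ?thesis using dom up le bounds by (auto simp: D_def n)
  qed
qed

termination a2
  using a2_dom_slow by blast

declare a2.simps(3) [simp del]

lemma a2_le: "a2 n \<le> n"
  using a2_dom_slow by blast

end

theory Submission
  imports Defs
begin

text \<open>By monotonicity of \<open>a2\<close>, the two summands in its recursion squeeze \<open>a2 k / 2\<close> between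
  \<open>a2 (k - a2 k)\<close> and \<open>a2 (k + 1 - a2 k)\<close>. Inductively, this says precisely that
  \<open>i = k + 1 - a2 k\<close> is the minimal index in the recursion of \<open>S2'\<close>.\<close>

lemma a2_Suc: "a2 n \<le> a2 (Suc n)" "a2 (Suc n) \<le> a2 n + 1"
  using a2_dom_slow[of "Suc n"] by auto

lemma a2_mono: "m \<le> n \<Longrightarrow> a2 m \<le> a2 n"
  by (rule lift_Suc_mono_le[of a2]) (rule a2_Suc)

lemma a2_2: "a2 2 = 2"
  using a2.simps(3)[of 2] by simp

text \<open>As \<open>a2\<close> grows by at most 1 per step, \<open>a2 k\<close> exceeds
  \<open>a2 (k - 1)\<close> by at most 1 and \<open>a2 (k - 2)\<close> by at most 2, so both
  arguments in the recursion are at most \<open>Suc k - a2 k\<close>.\<close>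

lemma a2_half_upper:
  assumes "k \<ge> 2"
  shows "a2 k \<le> 2 * a2 (Suc k - a2 k)"
proof -
  obtain j where k: "k = Suc (Suc j)"
    using assms by (metis add_2_eq_Suc le_Suc_ex)
  have "a2 (Suc j) \<le> Suc j" "a2 j \<le> j" by (rule a2_le)+
  then have "k - a2 (k - 1) \<le> Suc k - a2 k" "k - 1 - a2 (k - 2) \<le> Suc k - a2 k"
    using a2_Suc[of j] a2_Suc[of "Suc j"] by (auto simp: k)
  then have "a2 (k - a2 (k - 1)) \<le> a2 (Suc k - a2 k)"
    "a2 (k - 1 - a2 (k - 2)) \<le> a2 (Suc k - a2 k)"
    by (auto intro: a2_mono)
  then show ?thesis
    using a2.simps(3)[OF assms] by linarith
qed

text \<open>Both arguments in the recursion are at least \<open>k - a2 k\<close>, unless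
  \<open>a2\<close> is constant on \<open>k - 2\<close>, \<open>k - 1\<close>, \<open>k\<close>; in
  that case the recursion at \<open>k - 1\<close> is needed as well.\<close>

lemma a2_half_lower:
  assumes "k \<ge> 2"
  shows "2 * a2 (k - a2 k) \<le> a2 k"
proof -
  \<comment> \<open>The recursions at \<open>k\<close> and, for \<open>k\<close> at least 3, at
    \<open>k - 1\<close> share the summand \<open>a2 q\<close>.\<close>
  define p q r where "p = k - 2 - a2 (k - 3)" and "q = k - 1 - a2 (k - 2)"
    and "r = k - a2 (k - 1)"
  have a2_k: "a2 k = a2 r + a2 q"
    using a2.simps(3)[OF assms] by (simp add: q_def r_def)
  obtain j where k: "k = Suc (Suc j)"
    using assms by (metis add_2_eq_Suc le_Suc_ex)
  have steps: "a2 j \<le> a2 (Suc j)" "a2 (Suc j) \<le> a2 k"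
    using a2_Suc by (auto simp: k)
  have "q \<le> r"
    using a2_Suc(2)[of j] a2_le[of j] by (auto simp: k q_def r_def)
  then have qr: "a2 q \<le> a2 r" by (rule a2_mono)
  show ?thesis
  proof (cases "a2 j < a2 k")
    case True
    then have "k - a2 k \<le> q" by (auto simp: k q_def)
    then have "a2 (k - a2 k) \<le> a2 q" by (rule a2_mono)
    then show ?thesis using a2_k qr by linarith
  next
    case False
    then have eq: "a2 (Suc j) = a2 k" "a2 j = a2 k" using steps by auto
    \<comment> \<open>\<open>a2\<close> differs at 0 and 1, so \<open>k\<close> is at least 3 and
      the recursion applies at \<open>k - 1\<close>.\<close>
    have "j \<noteq> 0" using eq by (metis a2.simps(1,2) zero_neq_one)
    then obtain i where j: "j = Suc i" by (cases j) auto
    have a2_k1: "a2 (Suc j) = a2 q + a2 p"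
      using a2.simps(3)[of "Suc j"] by (simp add: k j p_def q_def)
    have "p \<le> q"
      using a2_Suc(2)[of i] a2_le[of i] by (auto simp: k j p_def q_def)
    then have "a2 p \<le> a2 q" by (rule a2_mono)
    \<comment> \<open>Cancelling \<open>a2 q\<close> gives \<open>a2 p = a2 r\<close>, and
      \<open>a2 q\<close> lies between them.\<close>
    then have "a2 q = a2 r" using a2_k a2_k1 eq qr by linarith
    moreover have "k - a2 k = r" using eq by (simp add: k r_def)
    ultimately show ?thesis using a2_k by simp
  qed
qed

theorem corollary4p16:
  fixes k :: nat
  shows "S2' k = 2 * a2 k"
proof (induction k rule: less_induct)
  case (less k)
  consider "k = 0" | "k = Suc 0" | "k \<ge> 2" by linarith
  then show ?case
  proof cases
    case 3
    \<comment> \<open>The bounds \<open>ge\<close> and \<open>le\<close> place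
      \<open>Suc k - a2 k\<close> in \<open>{1..k - 1}\<close>, where the induction hypothesis
      applies.\<close>
    have ge: "a2 k \<ge> 2" using a2_mono[OF 3] a2_2 by simp
    have le: "a2 k \<le> k" by (rule a2_le)
    have "(LEAST i. i \<in> {1..k - 1} \<and> k - i + 1 \<le> S2' i) = Suc k - a2 k"
    proof (rule Least_equality)
      have "S2' (Suc k - a2 k) = 2 * a2 (Suc k - a2 k)"
        using ge le by (intro less.IH) linarith
      then show "Suc k - a2 k \<in> {1..k - 1} \<and> k - (Suc k - a2 k) + 1 \<le> S2' (Suc k - a2 k)"
        using a2_half_upper[OF 3] ge le by auto
    next
      fix i
      assume i: "i \<in> {1..k - 1} \<and> k - i + 1 \<le> S2' i"
      then have S: "k - i + 1 \<le> 2 * a2 i" using less.IH[of i] 3 by auto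
      show "Suc k - a2 k \<le> i"
      proof (rule ccontr)
        assume "\<not> Suc k - a2 k \<le> i"
        \<comment> \<open>For such \<open>i\<close>, \<open>k - i + 1\<close> exceeds
          \<open>a2 k\<close>, which already bounds \<open>2 * a2 i\<close>.\<close>
        then have i_le: "i \<le> k - a2 k" by linarith
        then have "2 * a2 i \<le> a2 k"
          using a2_mono[OF i_le] a2_half_lower[OF 3] by linarith
        then show False using S i_le le by linarith
      qed
    qed
    then show ?thesis
      using ge le by (subst S2'.simps(3)[OF 3]) (simp add: Let_def)
  qed simp_all
qed

end
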